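(* (Two equivalent Hamiltonian descriptions of the sine-Gordon model.) Let $m,\beta$ be nonzero real constants. Let $$H_S=\int\Big[\tfrac12\pi^2+\tfrac12\phi_x^2+\tfrac{m^2}{\beta^2}(1-\cos\beta\phi)\Big]dx,\qquad H_T=\int\Big[-\tfrac12\Pi^2-\tfrac12\phi_t^2+\tfrac{m^2}{\beta^2}(1-\cos\beta\phi)\Big]dt .$$ Then the sine-Gordon equation $$\phi_{tt}-\phi_{xx}+\frac{m^2}{\beta}\sin\beta\phi=0$$ is recovered both from the Hamiltonian equations for time evolution $$\phi_t=\{\phi,H_S\}_S,\qquad \pi_t=\{\pi,H_S\}_S,$$ and from the Hamiltonian equations for space evolution $$\phi_x=\{\phi,H_T\}_T,\qquad \Pi_x=\{\Pi,H_T\}_T .$$ That is, each of these two systems is equivalent to the sine-Gordon equation for $\phi$, together with $\pi=\phi_t$ for the first system and $\Pi=-\phi_x$ for the second.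
   Context: The equal-time bracket $\{\ ,\ \}_S$ is defined at fixed time $t_0$ by $\{\phi(x,t_0),\pi(y,t_0)\}_S=\delta(x-y)$ and $\{\phi(x,t_0),\phi(y,t_0)\}_S=0=\{\pi(x,t_0),\pi(y,t_0)\}_S$. The equal-space bracket $\{\ ,\ \}_T$ is defined at fixed position $x_0$ by $\{\phi(x_0,t),\Pi(x_0,\tau)\}_T=\delta(t-\tau)$ and $\{\phi(x_0,t),\phi(x_0,\tau)\}_T=0=\{\Pi(x_0,t),\Pi(x_0,\tau)\}_T$. In the first picture the fields are functions of $x$ with $\phi\to 2\pi Q_\pm/\beta$ as $x\to\pm\infty$ ($Q_\pm\in\mathbb Z$) and $\pi\to0$ as $|x|\to\infty$. In the second picture they are functions of $t$ with $\phi\to2\pi\mathcal Q_\pm/\beta$ as $t\to\pm\infty$ ($\mathcal Q_\pm\in\mathbb Z$) and $\Pi\to0$ as $|t|\to\infty$. In both cases the limits are approached in the Schwartz sense. (In these limits $2\pi$ involves the number $\pi$, not the momentum field.) Integrals are over the whole real line. *)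

theory Defs
  imports "HOL-Analysis.Analysis" "HOL-Probability.Sinc_Integral"
begin

section \<open>Fields of one real variable and their boundary conditions\<close>

definition smooth :: "(real \<Rightarrow> real) \<Rightarrow> bool" where
  "smooth f \<longleftrightarrow> (\<forall>n x. ((deriv ^^ n) f) differentiable (at x))"

text \<open>\<open>f \<rightarrow> c\<close> along \<open>F\<close> (\<open>at_top\<close> or \<open>at_bot\<close>) in the Schwartz sense: \<open>f - c\<close> and all its
  derivatives vanish faster than any power.\<close>

definition schwartz_tends :: "(real \<Rightarrow> real) \<Rightarrow> real \<Rightarrow> real filter \<Rightarrow> bool" where
  "schwartz_tends f c F \<longleftrightarrow>
     (\<forall>k n. ((\<lambda>x. x ^ k * (deriv ^^ n) (\<lambda>y. f y - c) x) \<longlongrightarrow> 0) F)"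

definition schwartz :: "(real \<Rightarrow> real) \<Rightarrow> bool" where
  "schwartz f \<longleftrightarrow> smooth f \<and> schwartz_tends f 0 at_top \<and> schwartz_tends f 0 at_bot"

text \<open>Pairs (field, conjugate momentum) at a fixed time, as functions of \<open>x\<close>, or at a fixed
  position, as functions of \<open>t\<close>: the boundary conditions are the same in the two pictures.\<close>

definition phase_space :: "real \<Rightarrow> ((real \<Rightarrow> real) \<times> (real \<Rightarrow> real)) set" where
  "phase_space \<beta> = {(f, p). smooth f \<and> schwartz p \<and>
     (\<exists>Qm Qp :: int. schwartz_tends f (2 * pi * of_int Qm / \<beta>) at_bot \<and>
                     schwartz_tends f (2 * pi * of_int Qp / \<beta>) at_top)}"


section \<open>Functional derivatives and the canonical bracket\<close>

text \<open>The pairing \<open>\<langle>\<delta>F/\<delta>f, h\<rangle>\<close>, meaningful also when \<open>\<delta>F/\<delta>f\<close> is only a distribution: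
  for \<open>F f = f x\<close>, where \<open>\<delta>F/\<delta>f\<close> is the delta function at \<open>x\<close>, it is \<open>h x\<close>.\<close>

definition variation :: "((real \<Rightarrow> real) \<Rightarrow> real) \<Rightarrow> (real \<Rightarrow> real) \<Rightarrow> (real \<Rightarrow> real) \<Rightarrow> real" where
  "variation F f h = deriv (\<lambda>\<epsilon>. F (\<lambda>x. f x + \<epsilon> * h x)) 0"

definition has_functional_deriv ::
    "((real \<Rightarrow> real) \<Rightarrow> real) \<Rightarrow> (real \<Rightarrow> real) \<Rightarrow> (real \<Rightarrow> real) \<Rightarrow> bool" where
  "has_functional_deriv F f g \<longleftrightarrow> schwartz g \<and>
     (\<forall>h. schwartz h \<longrightarrow>
        ((\<lambda>\<epsilon>. F (\<lambda>x. f x + \<epsilon> * h x)) has_real_derivative (LBINT x. g x * h x)) (at 0))"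

definition functional_deriv :: "((real \<Rightarrow> real) \<Rightarrow> real) \<Rightarrow> (real \<Rightarrow> real) \<Rightarrow> (real \<Rightarrow> real)" where
  "functional_deriv F f = (THE g. has_functional_deriv F f g)"

text \<open>The bracket with \<open>{f(x), p(y)} = \<delta>(x - y)\<close> and \<open>{f(x), f(y)} = 0 = {p(x), p(y)}\<close>, that is,
  \<open>{F, G} = \<integral> (\<delta>F/\<delta>f(z) \<delta>G/\<delta>p(z) - \<delta>F/\<delta>p(z) \<delta>G/\<delta>f(z)) dz\<close> at the point \<open>(f, p)\<close>.
  The functional derivatives of \<open>G\<close> are functions; those of \<open>F\<close> may be distributions, so \<open>F\<close> can
  be a field at a point. The equal-time bracket is this bracket on functions of \<open>x\<close>, with
  \<open>p\<close> the momentum \<open>\<pi>\<close>; the equal-space bracket is this bracket on functions of \<open>t\<close>, with \<open>p\<close>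
  the momentum \<open>\<Pi>\<close>.\<close>

definition bracket ::
    "((real \<Rightarrow> real) \<Rightarrow> (real \<Rightarrow> real) \<Rightarrow> real) \<Rightarrow> ((real \<Rightarrow> real) \<Rightarrow> (real \<Rightarrow> real) \<Rightarrow> real) \<Rightarrow>
     (real \<Rightarrow> real) \<Rightarrow> (real \<Rightarrow> real) \<Rightarrow> real" where
  "bracket F G f p =
     variation (\<lambda>u. F u p) f (functional_deriv (\<lambda>v. G f v) p)
   - variation (\<lambda>v. F f v) p (functional_deriv (\<lambda>u. G u p) f)"

definition field_at :: "real \<Rightarrow> (real \<Rightarrow> real) \<Rightarrow> (real \<Rightarrow> real) \<Rightarrow> real" where
  "field_at x f p = f x"

definition momentum_at :: "real \<Rightarrow> (real \<Rightarrow> real) \<Rightarrow> (real \<Rightarrow> real) \<Rightarrow> real" where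
  "momentum_at x f p = p x"


section \<open>The two Hamiltonians and the sine-Gordon equation\<close>

definition H_S :: "real \<Rightarrow> real \<Rightarrow> (real \<Rightarrow> real) \<Rightarrow> (real \<Rightarrow> real) \<Rightarrow> real" where
  "H_S m \<beta> f p = (LBINT x. 1/2 * (p x)\<^sup>2 + 1/2 * (deriv f x)\<^sup>2 + m\<^sup>2 / \<beta>\<^sup>2 * (1 - cos (\<beta> * f x)))"

definition H_T :: "real \<Rightarrow> real \<Rightarrow> (real \<Rightarrow> real) \<Rightarrow> (real \<Rightarrow> real) \<Rightarrow> real" where
  "H_T m \<beta> f p = (LBINT t. - 1/2 * (p t)\<^sup>2 - 1/2 * (deriv f t)\<^sup>2 + m\<^sup>2 / \<beta>\<^sup>2 * (1 - cos (\<beta> * f t)))"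

text \<open>Fields on spacetime are functions of position and time, in this order.\<close>

definition D\<^sub>x :: "(real \<Rightarrow> real \<Rightarrow> real) \<Rightarrow> real \<Rightarrow> real \<Rightarrow> real" where
  "D\<^sub>x \<phi> x t = deriv (\<lambda>y. \<phi> y t) x"

definition D\<^sub>t :: "(real \<Rightarrow> real \<Rightarrow> real) \<Rightarrow> real \<Rightarrow> real \<Rightarrow> real" where
  "D\<^sub>t \<phi> x t = deriv (\<lambda>s. \<phi> x s) t"

definition x_differentiable :: "(real \<Rightarrow> real \<Rightarrow> real) \<Rightarrow> bool" where
  "x_differentiable \<phi> \<longleftrightarrow> (\<forall>x t. (\<lambda>y. \<phi> y t) differentiable (at x))"

definition t_differentiable :: "(real \<Rightarrow> real \<Rightarrow> real) \<Rightarrow> bool" where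
  "t_differentiable \<phi> \<longleftrightarrow> (\<forall>x t. (\<lambda>s. \<phi> x s) differentiable (at t))"

definition sine_gordon :: "real \<Rightarrow> real \<Rightarrow> (real \<Rightarrow> real \<Rightarrow> real) \<Rightarrow> bool" where
  "sine_gordon m \<beta> \<phi> \<longleftrightarrow>
     t_differentiable \<phi> \<and> t_differentiable (D\<^sub>t \<phi>) \<and>
     x_differentiable \<phi> \<and> x_differentiable (D\<^sub>x \<phi>) \<and>
     (\<forall>x t. D\<^sub>t (D\<^sub>t \<phi>) x t - D\<^sub>x (D\<^sub>x \<phi>) x t + m\<^sup>2 / \<beta> * sin (\<beta> * \<phi> x t) = 0)"

definition time_evolution :: "real \<Rightarrow> real \<Rightarrow> (real \<Rightarrow> real \<Rightarrow> real) \<Rightarrow> (real \<Rightarrow> real \<Rightarrow> real) \<Rightarrow> bool" where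
  "time_evolution m \<beta> \<phi> p \<longleftrightarrow>
     t_differentiable \<phi> \<and> t_differentiable p \<and>
     (\<forall>x t. D\<^sub>t \<phi> x t = bracket (field_at x) (H_S m \<beta>) (\<lambda>y. \<phi> y t) (\<lambda>y. p y t)) \<and>
     (\<forall>x t. D\<^sub>t p x t = bracket (momentum_at x) (H_S m \<beta>) (\<lambda>y. \<phi> y t) (\<lambda>y. p y t))"

definition space_evolution :: "real \<Rightarrow> real \<Rightarrow> (real \<Rightarrow> real \<Rightarrow> real) \<Rightarrow> (real \<Rightarrow> real \<Rightarrow> real) \<Rightarrow> bool" where
  "space_evolution m \<beta> \<phi> P \<longleftrightarrow>
     x_differentiable \<phi> \<and> x_differentiable P \<and>
     (\<forall>x t. D\<^sub>x \<phi> x t = bracket (field_at t) (H_T m \<beta>) (\<lambda>s. \<phi> x s) (\<lambda>s. P x s)) \<and>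
     (\<forall>x t. D\<^sub>x P x t = bracket (momentum_at t) (H_T m \<beta>) (\<lambda>s. \<phi> x s) (\<lambda>s. P x s))"


section \<open>Functional derivatives are unique, and the bracket is canonical\<close>

lemma smooth_deriv_diff:
  assumes "smooth f" "smooth g"
  shows "(deriv ^^ n) (\<lambda>x. f x - g x) = (\<lambda>x. (deriv ^^ n) f x - (deriv ^^ n) g x)"
proof (induction n)
  case (Suc n)
  have "deriv (\<lambda>x. (deriv ^^ n) f x - (deriv ^^ n) g x) x
      = deriv ((deriv ^^ n) f) x - deriv ((deriv ^^ n) g) x" for x
    using assms unfolding smooth_def
    by (intro deriv_diff) (auto simp: field_differentiable_def real_differentiable_def)
  then show ?case using Suc by auto
qed auto

lemma schwartz_diff:
  assumes "schwartz f" "schwartz g"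
  shows "schwartz (\<lambda>x. f x - g x)"
proof -
  have s: "smooth f" "smooth g" using assms by (auto simp: schwartz_def)
  have "smooth (\<lambda>x. f x - g x)"
    using s by (auto simp: smooth_def smooth_deriv_diff[OF s])
  moreover have "schwartz_tends (\<lambda>x. f x - g x) 0 F"
    if "schwartz_tends f 0 F" "schwartz_tends g 0 F" for F
    unfolding schwartz_tends_def
  proof (intro allI)
    fix k n
    have "((\<lambda>x. x ^ k * (deriv ^^ n) f x - x ^ k * (deriv ^^ n) g x) \<longlongrightarrow> 0 - 0) F"
      using that by (intro tendsto_diff) (auto simp: schwartz_tends_def)
    then show "((\<lambda>x. x ^ k * (deriv ^^ n) (\<lambda>y. f y - g y - 0) x) \<longlongrightarrow> 0) F"
      by (simp add: smooth_deriv_diff[OF s] algebra_simps)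
  qed
  ultimately show ?thesis using assms by (simp add: schwartz_def)
qed

lemma schwartz_tendsto:
  assumes "schwartz f"
  shows "((\<lambda>x. x ^ k * f x) \<longlongrightarrow> 0) at_top" "((\<lambda>x. x ^ k * f x) \<longlongrightarrow> 0) at_bot"
proof -
  have "((\<lambda>x. x ^ k * (deriv ^^ 0) (\<lambda>y. f y - 0) x) \<longlongrightarrow> 0) at_top"
       "((\<lambda>x. x ^ k * (deriv ^^ 0) (\<lambda>y. f y - 0) x) \<longlongrightarrow> 0) at_bot"
    using assms unfolding schwartz_def schwartz_tends_def by blast+
  then show "((\<lambda>x. x ^ k * f x) \<longlongrightarrow> 0) at_top" "((\<lambda>x. x ^ k * f x) \<longlongrightarrow> 0) at_bot"
    by simp_all
qed

lemma schwartz_continuous: "schwartz f \<Longrightarrow> continuous_on UNIV f"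
  unfolding schwartz_def smooth_def
  by (auto dest!: spec[where x = "0::nat"] intro!: continuous_at_imp_continuous_on
      differentiable_imp_continuous_within)

lemma integrable_fast_decay:
  fixes f :: "real \<Rightarrow> real"
  assumes c: "continuous_on UNIV f"
    and top: "((\<lambda>x. (1 + x\<^sup>2) * f x) \<longlongrightarrow> 0) at_top"
    and bot: "((\<lambda>x. (1 + x\<^sup>2) * f x) \<longlongrightarrow> 0) at_bot"
  shows "integrable lborel f"
proof -
  let ?h = "\<lambda>x. (1 + x\<^sup>2) * f x"
  have ch: "continuous_on A ?h" for A
    by (intro continuous_intros continuous_on_subset[OF c]) auto
  have "eventually (\<lambda>x. \<bar>?h x\<bar> < 1) at_top" "eventually (\<lambda>x. \<bar>?h x\<bar> < 1) at_bot"
    using tendstoD[OF top, of 1] tendstoD[OF bot, of 1] by (auto simp: dist_real_def)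
  then obtain a b where a: "\<And>x. x \<ge> a \<Longrightarrow> \<bar>?h x\<bar> < 1" and b: "\<And>x. x \<le> b \<Longrightarrow> \<bar>?h x\<bar> < 1"
    unfolding eventually_at_top_linorder eventually_at_bot_linorder by blast
  have "bounded (?h ` {b..a})"
    by (intro compact_imp_bounded compact_continuous_image ch) auto
  then obtain K where K: "\<And>x. x \<in> {b..a} \<Longrightarrow> \<bar>?h x\<bar> \<le> K"
    unfolding bounded_iff by (metis imageI real_norm_def)
  have bd: "\<bar>?h x\<bar> \<le> max 1 K" for x
    using a[of x] b[of x] K[of x] by (cases "x \<ge> a"; cases "x \<le> b") auto
  have I: "integrable lborel (\<lambda>x. max 1 K * inverse (1 + x\<^sup>2))"
    using integrable_inverse_1_plus_square
    by (intro integrable_mult_right) (simp add: set_integrable_def einterval_def)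
  show ?thesis
  proof (rule Bochner_Integration.integrable_bound[OF I])
    show "f \<in> borel_measurable lborel"
      using borel_measurable_continuous_onI[OF c] by simp
    show "AE x in lborel. norm (f x) \<le> norm (max 1 K * inverse (1 + x\<^sup>2))"
    proof (rule AE_I2)
      fix x :: real
      have p: "1 + x\<^sup>2 > 0" by (simp add: add_pos_nonneg)
      have "\<bar>f x\<bar> = \<bar>?h x\<bar> * inverse (1 + x\<^sup>2)" using p by (simp add: abs_mult)
      also have "\<dots> \<le> max 1 K * inverse (1 + x\<^sup>2)"
        using bd[of x] p by (intro mult_right_mono) auto
      finally show "norm (f x) \<le> norm (max 1 K * inverse (1 + x\<^sup>2))" by simp
    qed
  qed
qed

lemma integrable_schwartz_mult:
  assumes "schwartz f" "schwartz g"
  shows "integrable lborel (\<lambda>x. f x * g x)"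
proof (rule integrable_fast_decay)
  show "continuous_on UNIV (\<lambda>x. f x * g x)"
    using assms by (intro continuous_intros schwartz_continuous)
  have *: "((\<lambda>x. (1 + x\<^sup>2) * (f x * g x)) \<longlongrightarrow> 0) F"
    if "\<And>k. ((\<lambda>x. x ^ k * f x) \<longlongrightarrow> 0) F" "\<And>k. ((\<lambda>x. x ^ k * g x) \<longlongrightarrow> 0) F" for F
  proof -
    have "((\<lambda>x. (x ^ 0 * f x + x ^ 2 * f x) * (x ^ 0 * g x)) \<longlongrightarrow> (0 + 0) * 0) F"
      by (intro tendsto_intros that)
    then show ?thesis by (simp add: algebra_simps)
  qed
  show "((\<lambda>x. (1 + x\<^sup>2) * (f x * g x)) \<longlongrightarrow> 0) at_top"
       "((\<lambda>x. (1 + x\<^sup>2) * (f x * g x)) \<longlongrightarrow> 0) at_bot"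
    by (intro * schwartz_tendsto assms)+
qed

lemma has_functional_deriv_unique:
  assumes "has_functional_deriv F f g1" "has_functional_deriv F f g2"
  shows "g1 = g2"
proof -
  have s: "schwartz g1" "schwartz g2" using assms by (auto simp: has_functional_deriv_def)
  define h where "h = (\<lambda>x. g1 x - g2 x)"
  have sh: "schwartz h" unfolding h_def by (intro schwartz_diff s)
  have "(LBINT x. g1 x * h x) = (LBINT x. g2 x * h x)"
    using assms sh unfolding has_functional_deriv_def by (blast intro: DERIV_unique)
  then have "(LBINT x. g1 x * h x - g2 x * h x) = 0"
    using integrable_schwartz_mult[OF s(1) sh] integrable_schwartz_mult[OF s(2) sh] by simp
  then have 0: "(LBINT x. h x * h x) = 0" by (simp add: h_def algebra_simps)
  have "AE x in lborel. h x * h x = 0"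
    using integral_nonneg_eq_0_iff_AE[OF integrable_schwartz_mult[OF sh sh]] 0 by simp
  then have ae: "AE x in lborel. x \<in> {x. h x = 0}" by simp
  have "closed {x. h x = 0}"
    using continuous_closed_preimage_constant[OF schwartz_continuous[OF sh] closed_UNIV, of 0]
    by simp
  then have "{x. h x = 0} = UNIV"
    using ae by (metis mem_closed_if_AE_lebesgue AE_completion UNIV_eq_I)
  then show ?thesis by (auto simp: h_def fun_eq_iff)
qed

lemma functional_deriv_eq:
  "has_functional_deriv F f g \<Longrightarrow> functional_deriv F f = g"
  unfolding functional_deriv_def by (blast intro: the_equality has_functional_deriv_unique)

lemma schwartz_0: "schwartz (\<lambda>x. 0)"
proof -
  have "(deriv ^^ n) (\<lambda>x::real. 0::real) = (\<lambda>x. 0)" for n by (induction n) auto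
  then show ?thesis by (simp add: schwartz_def smooth_def schwartz_tends_def)
qed

lemma functional_deriv_const: "functional_deriv (\<lambda>u. c) f = (\<lambda>x. 0)"
  by (rule functional_deriv_eq) (simp add: has_functional_deriv_def schwartz_0)

lemma bracket_field_field: "bracket (field_at x) (field_at y) f p = 0"
  by (simp add: bracket_def field_at_def variation_def functional_deriv_const)

lemma bracket_momentum_momentum: "bracket (momentum_at x) (momentum_at y) f p = 0"
  by (simp add: bracket_def momentum_at_def variation_def functional_deriv_const)

text \<open>\<open>{f(x), p(y)} = \<delta>(x - y)\<close>, integrated against a test function \<open>g(y)\<close>.\<close>

lemma bracket_field_momentum:
  assumes g: "schwartz g" and p: "schwartz p"
  shows "bracket (field_at x) (\<lambda>u v. LBINT y. g y * momentum_at y u v) f p = g x"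
proof -
  have "has_functional_deriv (\<lambda>v. LBINT y. g y * v y) p g"
    unfolding has_functional_deriv_def
  proof (intro conjI allI impI g)
    fix h assume h: "schwartz h"
    have "(LBINT y. g y * (p y + \<epsilon> * h y)) = (LBINT y. g y * p y) + \<epsilon> * (LBINT y. g y * h y)" for \<epsilon>
    proof -
      have "(LBINT y. g y * (p y + \<epsilon> * h y)) = (LBINT y. g y * p y + \<epsilon> * (g y * h y))"
        by (simp add: algebra_simps)
      then show ?thesis
        using integrable_schwartz_mult[OF g p] integrable_schwartz_mult[OF g h] by simp
    qed
    then show "((\<lambda>\<epsilon>. LBINT y. g y * (p y + \<epsilon> * h y)) has_real_derivative (LBINT y. g y * h y)) (at 0)"
      by (auto intro!: derivative_eq_intros)
  qed
  then have "functional_deriv (\<lambda>v. LBINT y. g y * v y) p = g" by (rule functional_deriv_eq)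
  moreover have "deriv (\<lambda>\<epsilon>. f x + \<epsilon> * g x) 0 = g x"
    by (rule DERIV_imp_deriv) (auto intro!: derivative_eq_intros)
  ultimately show ?thesis
    by (simp add: bracket_def field_at_def momentum_at_def variation_def)
qed

end

theory Submission
  imports Defs
begin

text \<open>At a point of phase space the functional derivatives of \<open>\<integral> (s/2 p\<^sup>2 + s/2 f'\<^sup>2 + V(f)) dx\<close>,
  with \<open>s = 1\<close> for \<open>H_S\<close> and \<open>s = -1\<close> for \<open>H_T\<close>, are \<open>s p\<close> and, after an integration by parts,
  \<open>- s f'' + V'(f)\<close>. Both are Schwartz functions: since \<open>f\<close> tends to multiples of \<open>2\<pi>/\<beta>\<close>,
  \<open>sin (\<beta> f)\<close> decays together with \<open>f - 2\<pi>Q/\<beta>\<close>, and its derivatives contain the Schwartz factor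
  \<open>f'\<close>. The Taylor remainder in the direction \<open>h\<close> is pointwise quadratic in the parameter with an
  integrable coefficient, so differentiation under the integral needs no convergence theorem.
  The Hamiltonian equations thus read \<open>\<phi>\<^sub>t = \<pi>\<close>, \<open>\<pi>\<^sub>t = \<phi>\<^sub>x\<^sub>x - V'(\<phi>)\<close> and
  \<open>\<phi>\<^sub>x = - \<Pi>\<close>, \<open>\<Pi>\<^sub>x = - \<phi>\<^sub>t\<^sub>t - V'(\<phi>)\<close>.\<close>

section \<open>Closure properties of Schwartz functions\<close>

text \<open>Capping the order allows induction on \<open>n\<close>: the product rule expresses order
  \<open>Suc n\<close> of a product through order \<open>n\<close> of its terms, so the full Leibniz
  formula is avoided.\<close>

definition derivs_upto :: "((real \<Rightarrow> real) \<Rightarrow> bool) \<Rightarrow> nat \<Rightarrow> (real \<Rightarrow> real) \<Rightarrow> bool" where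
  "derivs_upto P n u \<longleftrightarrow> (\<forall>j\<le>n. P ((deriv ^^ j) u))"

lemma derivs_upto_0: "derivs_upto P 0 u \<longleftrightarrow> P u"
  by (simp add: derivs_upto_def)

text \<open>Peeling off the innermost derivative yields the recursion on which the inductions over
  the order run.\<close>

lemma derivs_upto_Suc: "derivs_upto P (Suc n) u \<longleftrightarrow> P u \<and> derivs_upto P n (deriv u)"
proof -
  have "(\<forall>j\<le>Suc n. P ((deriv ^^ j) u)) \<longleftrightarrow> P u \<and> (\<forall>j\<le>n. P ((deriv ^^ Suc j) u))"
    by (metis Suc_le_mono funpow_0 le0 not0_implies_Suc)
  then show ?thesis
    by (simp add: derivs_upto_def funpow_Suc_right del: funpow.simps)
qed

lemma derivs_upto_base: "derivs_upto P n u \<Longrightarrow> P u"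
  by (cases n) (auto simp: derivs_upto_0 derivs_upto_Suc)

lemma derivs_upto_SucD: "derivs_upto P (Suc n) u \<Longrightarrow> derivs_upto P n u"
  by (simp add: derivs_upto_def)

lemma derivs_upto_mono: "derivs_upto P n u \<Longrightarrow> (\<And>v. P v \<Longrightarrow> Q v) \<Longrightarrow> derivs_upto Q n u"
  by (simp add: derivs_upto_def)

section \<open>Decay and boundedness at the two ends\<close>

definition decays :: "real filter \<Rightarrow> (real \<Rightarrow> real) \<Rightarrow> bool" where
  "decays F u \<longleftrightarrow> (\<forall>k. ((\<lambda>x. x ^ k * u x) \<longlongrightarrow> 0) F)"

definition rapid :: "(real \<Rightarrow> real) \<Rightarrow> bool" where
  "rapid u \<longleftrightarrow> (\<forall>x. u differentiable at x) \<and> decays at_top u \<and> decays at_bot u"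

text \<open>The multipliers of rapidly decaying functions. Bounds near the two ends suffice, since
  decay is a condition along \<open>at_top\<close> and \<open>at_bot\<close> only.\<close>

definition tame :: "(real \<Rightarrow> real) \<Rightarrow> bool" where
  "tame u \<longleftrightarrow> (\<forall>x. u differentiable at x) \<and> Bfun u at_top \<and> Bfun u at_bot"

lemma decays_add: "decays F u \<Longrightarrow> decays F v \<Longrightarrow> decays F (\<lambda>x. u x + v x)"
  unfolding decays_def by (auto simp: distrib_left intro: tendsto_add_zero)

lemma decays_mult_Bfun:
  assumes "decays F u" "Bfun v F"
  shows "decays F (\<lambda>x. u x * v x)"
  unfolding decays_def
proof
  fix k
  have "Zfun (\<lambda>x. x ^ k * u x) F"
    using assms(1) by (simp add: decays_def tendsto_Zfun_iff)
  then have "Zfun (\<lambda>x. x ^ k * u x * v x) F"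
    using assms(2) by (rule bounded_bilinear.Zfun_prod_Bfun[OF bounded_bilinear_mult])
  then show "((\<lambda>x. x ^ k * (u x * v x)) \<longlongrightarrow> 0) F"
    by (simp add: tendsto_Zfun_iff mult.assoc)
qed

text \<open>Carries the decay of a field's deviation from its vacuum value over to trigonometric
  functions of the field, via Lipschitz estimates.\<close>

lemma decays_bound:
  assumes "decays F u" "\<And>x. \<bar>v x\<bar> \<le> c * \<bar>u x\<bar>"
  shows "decays F v"
  unfolding decays_def
proof
  fix k
  have lim: "((\<lambda>x. c * \<bar>x ^ k * u x\<bar>) \<longlongrightarrow> 0) F"
    using assms(1) unfolding decays_def
    by (intro tendsto_mult_right_zero tendsto_rabs_zero) auto
  have "norm (x ^ k * v x) \<le> c * \<bar>x ^ k * u x\<bar>" for x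
    using mult_left_mono[OF assms(2), of "\<bar>x ^ k\<bar>" x] by (simp add: abs_mult algebra_simps)
  then show "((\<lambda>x. x ^ k * v x) \<longlongrightarrow> 0) F"
    by (intro Lim_null_comparison[OF _ lim] always_eventually allI)
qed

lemma Bfun_decays:
  assumes "decays F u"
  shows "Bfun u F"
proof -
  have "((\<lambda>x. x ^ 0 * u x) \<longlongrightarrow> 0) F"
    using assms unfolding decays_def by blast
  then have "(u \<longlongrightarrow> 0) F" by simp
  then have "eventually (\<lambda>x. norm (u x) \<le> 1) F"
    using tendstoD[of u 0 F 1] by (auto elim: eventually_mono)
  then show ?thesis by (rule BfunI)
qed

lemma rapid_imp_tame: "rapid u \<Longrightarrow> tame u"
  by (simp add: rapid_def tame_def Bfun_decays)

lemma rapid_add: "rapid u \<Longrightarrow> rapid v \<Longrightarrow> rapid (\<lambda>x. u x + v x)"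
  by (auto simp: rapid_def decays_add)

lemma rapid_mult_tame: "rapid u \<Longrightarrow> tame v \<Longrightarrow> rapid (\<lambda>x. u x * v x)"
  by (auto simp: rapid_def tame_def decays_mult_Bfun)

section \<open>Sums and products to all orders\<close>

lemma deriv_plus_real:
  fixes u v :: "real \<Rightarrow> real"
  assumes "\<forall>x. u differentiable at x" "\<forall>x. v differentiable at x"
  shows "deriv (\<lambda>x. u x + v x) = (\<lambda>x. deriv u x + deriv v x)"
  using assms
  by (intro ext DERIV_imp_deriv DERIV_add) (auto simp: DERIV_deriv_iff_real_differentiable)

lemma deriv_times_real:
  fixes u v :: "real \<Rightarrow> real"
  assumes "\<forall>x. u differentiable at x" "\<forall>x. v differentiable at x"
  shows "deriv (\<lambda>x. u x * v x) = (\<lambda>x. deriv u x * v x + u x * deriv v x)"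
proof
  fix x
  have "(u has_real_derivative deriv u x) (at x)" "(v has_real_derivative deriv v x) (at x)"
    using assms by (auto simp: DERIV_deriv_iff_real_differentiable)
  then show "deriv (\<lambda>x. u x * v x) x = deriv u x * v x + u x * deriv v x"
    by (intro DERIV_imp_deriv) (auto intro!: derivative_eq_intros)
qed

lemma derivs_upto_rapid_add:
  "derivs_upto rapid n u \<Longrightarrow> derivs_upto rapid n v \<Longrightarrow> derivs_upto rapid n (\<lambda>x. u x + v x)"
proof (induction n arbitrary: u v)
  case 0
  then show ?case by (simp add: derivs_upto_0 rapid_add)
next
  case (Suc n)
  have "deriv (\<lambda>x. u x + v x) = (\<lambda>x. deriv u x + deriv v x)"
    using Suc.prems by (intro deriv_plus_real) (auto simp: derivs_upto_Suc rapid_def)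
  with Suc show ?case by (simp add: derivs_upto_Suc rapid_add)
qed

text \<open>Induction through (u v)' = u' v + u v': each summand is again a rapid factor times a
  tame one, known up to order \<open>n\<close>. Hence both factors are generalised.\<close>

lemma derivs_upto_rapid_mult:
  "derivs_upto rapid n u \<Longrightarrow> derivs_upto tame n v \<Longrightarrow> derivs_upto rapid n (\<lambda>x. u x * v x)"
proof (induction n arbitrary: u v)
  case 0
  then show ?case by (simp add: derivs_upto_0 rapid_mult_tame)
next
  case (Suc n)
  have uv: "rapid u" "tame v" and d: "derivs_upto rapid n (deriv u)" "derivs_upto tame n (deriv v)"
    using Suc.prems by (auto simp: derivs_upto_Suc)
  have "deriv (\<lambda>x. u x * v x) = (\<lambda>x. deriv u x * v x + u x * deriv v x)"
    using uv by (intro deriv_times_real) (auto simp: rapid_def tame_def)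
  moreover have "derivs_upto rapid n (\<lambda>x. deriv u x * v x + u x * deriv v x)"
    using Suc.prems[THEN derivs_upto_SucD] d by (intro derivs_upto_rapid_add Suc.IH)
  ultimately show ?case using uv by (simp add: derivs_upto_Suc rapid_mult_tame)
qed

text \<open>The constant in \<open>schwartz_tends\<close> is zero here, so the condition concerns
  each derivative separately: it is differentiable and decays at both ends.\<close>

lemma schwartz_iff: "schwartz u \<longleftrightarrow> (\<forall>n. derivs_upto rapid n u)"
proof -
  have "schwartz u \<longleftrightarrow> (\<forall>n. rapid ((deriv ^^ n) u))"
    by (auto simp: schwartz_def smooth_def schwartz_tends_def rapid_def decays_def)
  then show ?thesis by (auto simp: derivs_upto_def)
qed

lemma schwartz_rapid: "schwartz u \<Longrightarrow> rapid u"
  using derivs_upto_base by (auto simp: schwartz_iff)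

lemma schwartz_differentiable: "schwartz u \<Longrightarrow> u differentiable at x"
  using schwartz_rapid by (auto simp: rapid_def)

lemma schwartz_decays: "schwartz u \<Longrightarrow> decays at_top u" "schwartz u \<Longrightarrow> decays at_bot u"
  using schwartz_rapid by (auto simp: rapid_def)

lemma schwartz_deriv: "schwartz u \<Longrightarrow> schwartz (deriv u)"
  unfolding schwartz_iff using derivs_upto_Suc[of rapid _ u] by blast

lemma schwartz_add: "schwartz u \<Longrightarrow> schwartz v \<Longrightarrow> schwartz (\<lambda>x. u x + v x)"
  by (simp add: schwartz_iff derivs_upto_rapid_add)

lemma tame_const: "tame (\<lambda>x. c)"
  by (auto simp: tame_def)

lemma derivs_upto_tame_const: "derivs_upto tame n (\<lambda>x. c)"
proof -
  have "(deriv ^^ j) (\<lambda>x. c) = (\<lambda>x. if j = 0 then c else 0)" for j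
    by (induction j) auto
  then show ?thesis by (simp add: derivs_upto_def tame_const)
qed

lemma schwartz_cmult: "schwartz u \<Longrightarrow> schwartz (\<lambda>x. c * u x)"
  using derivs_upto_rapid_mult[of _ u "\<lambda>x. c"]
  by (simp add: schwartz_iff derivs_upto_tame_const mult.commute)


section \<open>Fields with vacuum asymptotics\<close>

text \<open>The values \<open>2 * pi * of_int Q / \<beta>\<close> are the zeros of the potential.
  The integer is chosen per end, so a field may join different vacua.\<close>

definition vacuum_limit :: "real \<Rightarrow> real filter \<Rightarrow> (real \<Rightarrow> real) \<Rightarrow> bool" where
  "vacuum_limit \<beta> F f \<longleftrightarrow> (\<exists>Q::int. decays F (\<lambda>x. f x - 2 * pi * of_int Q / \<beta>))"

text \<open>All conditions beyond order zero are put on the derivative, which, in general unlike the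
  field, is a Schwartz function. The charge is arbitrary: vacuum and antikink fields are
  included.\<close>

definition kink :: "real \<Rightarrow> (real \<Rightarrow> real) \<Rightarrow> bool" where
  "kink \<beta> f \<longleftrightarrow> (\<forall>x. f differentiable at x) \<and> schwartz (deriv f) \<and>
     vacuum_limit \<beta> at_top f \<and> vacuum_limit \<beta> at_bot f"

text \<open>The constant is visible at order zero only; the first derivative removes it.\<close>

lemma schwartz_tends_decomp:
  assumes "\<forall>x. f differentiable at x" "schwartz_tends f c F"
  shows "decays F (\<lambda>x. f x - c)" "schwartz_tends (deriv f) 0 F"
proof -
  have "((\<lambda>x. x ^ k * (deriv ^^ 0) (\<lambda>y. f y - c) x) \<longlongrightarrow> 0) F" for k
    using assms(2) unfolding schwartz_tends_def by blast
  then show "decays F (\<lambda>x. f x - c)" by (simp add: decays_def)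
  have "deriv (\<lambda>y. f y - c) = deriv f"
  proof
    fix x
    have "(f has_real_derivative deriv f x) (at x)"
      using assms(1) by (simp add: DERIV_deriv_iff_real_differentiable)
    then show "deriv (\<lambda>y. f y - c) x = deriv f x"
      by (intro DERIV_imp_deriv) (auto intro!: derivative_eq_intros)
  qed
  then have "(deriv ^^ Suc n) (\<lambda>y. f y - c) = (deriv ^^ n) (deriv f)" for n
    by (simp add: funpow_Suc_right del: funpow.simps)
  moreover have "((\<lambda>x. x ^ k * (deriv ^^ Suc n) (\<lambda>y. f y - c) x) \<longlongrightarrow> 0) F" for k n
    using assms(2) unfolding schwartz_tends_def by blast
  ultimately show "schwartz_tends (deriv f) 0 F"
    by (simp add: schwartz_tends_def del: funpow.simps)
qed

lemma phase_space_kink: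
  assumes "(f, p) \<in> phase_space \<beta>"
  shows "kink \<beta> f" "schwartz p"
proof -
  obtain Qm Qp :: int where f: "smooth f" "schwartz_tends f (2 * pi * of_int Qm / \<beta>) at_bot"
    "schwartz_tends f (2 * pi * of_int Qp / \<beta>) at_top" and p: "schwartz p"
    using assms by (auto simp: phase_space_def)
  have d: "\<forall>x. (deriv ^^ n) f differentiable at x" for n
    using f(1) by (simp add: smooth_def)
  have d0: "\<forall>x. f differentiable at x" using d[of 0] by simp
  have "smooth (deriv f)"
    using d[of "Suc _"] by (simp add: smooth_def funpow_Suc_right del: funpow.simps)
  then show "kink \<beta> f"
    using schwartz_tends_decomp[OF d0 f(2)] schwartz_tends_decomp[OF d0 f(3)] d0
    by (auto simp: kink_def vacuum_limit_def schwartz_def)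
  show "schwartz p" by (rule p)
qed

lemma vacuum_limit_add:
  "vacuum_limit \<beta> F f \<Longrightarrow> decays F h \<Longrightarrow> vacuum_limit \<beta> F (\<lambda>x. f x + h x)"
  unfolding vacuum_limit_def
  by (erule exE, rule exI, drule (1) decays_add) (simp add: diff_add_eq)

text \<open>Schwartz variations stay in the same topological sector, so the energy density remains
  integrable along them.\<close>

lemma kink_add:
  assumes "kink \<beta> f" "schwartz h"
  shows "kink \<beta> (\<lambda>x. f x + h x)"
proof -
  have "deriv (\<lambda>x. f x + h x) = (\<lambda>x. deriv f x + deriv h x)"
    using assms by (intro deriv_plus_real) (auto simp: kink_def schwartz_differentiable)
  then show ?thesis
    using assms by (auto simp: kink_def schwartz_differentiable schwartz_add schwartz_deriv
        intro!: vacuum_limit_add schwartz_decays)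
qed

text \<open>By periodicity \<open>\<beta> * f x\<close> may be replaced by \<open>\<beta>\<close>
  times the deviation from the vacuum, and both functions are bounded by a multiple of this
  deviation.\<close>

lemma vacuum_limit_trig:
  assumes "vacuum_limit \<beta> F f" "\<beta> \<noteq> 0"
  shows "decays F (\<lambda>x. sin (\<beta> * f x))" "decays F (\<lambda>x. 1 - cos (\<beta> * f x))"
proof -
  obtain Q :: int where Q: "decays F (\<lambda>x. f x - 2 * pi * of_int Q / \<beta>)"
    using assms by (auto simp: vacuum_limit_def)
  define y where "y x = \<beta> * (f x - 2 * pi * of_int Q / \<beta>)" for x
  have y: "\<beta> * f x = y x + 2 * pi * of_int Q" for x
    using assms(2) by (simp add: y_def field_simps)
  have sc: "sin (\<beta> * f x) = sin (y x)" "cos (\<beta> * f x) = cos (y x)" for x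
    by (simp_all add: y sin_add cos_add)
  have yb: "\<bar>y x\<bar> = \<bar>\<beta>\<bar> * \<bar>f x - 2 * pi * of_int Q / \<beta>\<bar>" for x
    by (simp add: y_def abs_mult)
  show "decays F (\<lambda>x. sin (\<beta> * f x))"
    using abs_sin_x_le_abs_x[of "y _"]
    by (intro decays_bound[OF Q, where c = "\<bar>\<beta>\<bar>"]) (simp add: sc yb)
  \<comment> \<open>A bound linear in \<open>a\<close> is the form that \<open>decays_bound\<close>
    accepts: of the two factors \<open>sin (a / 2)\<close>, one is estimated by 1.\<close>
  have "\<bar>1 - cos a\<bar> \<le> \<bar>a\<bar>" for a :: real
  proof -
    have "\<bar>1 - cos a\<bar> = 2 * (\<bar>sin (a / 2)\<bar> * \<bar>sin (a / 2)\<bar>)"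
      using cos_double_sin[of "a / 2"] by (simp add: power2_eq_square abs_mult)
    also have "\<dots> \<le> 2 * (1 * \<bar>a / 2\<bar>)"
      by (intro mult_left_mono mult_mono abs_sin_x_le_abs_x) auto
    finally show ?thesis by simp
  qed
  then show "decays F (\<lambda>x. 1 - cos (\<beta> * f x))"
    by (intro decays_bound[OF Q, where c = "\<bar>\<beta>\<bar>"]) (simp add: sc flip: yb)
qed

section \<open>Derivatives of sine and cosine of the field\<close>

lemma trig_comp_derivs:
  fixes f :: "real \<Rightarrow> real"
  assumes "\<forall>x. f differentiable at x"
  shows "((\<lambda>x. sin (\<beta> * f x)) has_real_derivative \<beta> * deriv f x * cos (\<beta> * f x)) (at x)"
    "((\<lambda>x. cos (\<beta> * f x)) has_real_derivative (- \<beta>) * deriv f x * sin (\<beta> * f x)) (at x)"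
proof -
  have [derivative_intros]: "(f has_real_derivative deriv f x) (at x)"
    using assms by (simp add: DERIV_deriv_iff_real_differentiable)
  show "((\<lambda>x. sin (\<beta> * f x)) has_real_derivative \<beta> * deriv f x * cos (\<beta> * f x)) (at x)"
    "((\<lambda>x. cos (\<beta> * f x)) has_real_derivative (- \<beta>) * deriv f x * sin (\<beta> * f x)) (at x)"
    by (auto intro!: derivative_eq_intros)
qed

lemma tame_trig:
  assumes "\<forall>x. f differentiable at x"
  shows "tame (\<lambda>x. sin (\<beta> * f x))" "tame (\<lambda>x. cos (\<beta> * f x))"
proof -
  have "Bfun (\<lambda>x. sin (\<beta> * f x)) F" "Bfun (\<lambda>x. cos (\<beta> * f x)) F" for F
    by (intro BfunI[where K = 1] always_eventually; simp)+
  then show "tame (\<lambda>x. sin (\<beta> * f x))" "tame (\<lambda>x. cos (\<beta> * f x))"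
    unfolding tame_def real_differentiable_def using trig_comp_derivs[OF assms, of \<beta>] by blast+
qed

text \<open>Differentiation exchanges sine and cosine, hence the joint induction. Each derivative
  carries the factor \<open>deriv f\<close>, so it is even rapid up to order
  \<open>n\<close>.\<close>

lemma derivs_upto_tame_trig:
  assumes f: "\<forall>x. f differentiable at x" "schwartz (deriv f)"
  shows "derivs_upto tame n (\<lambda>x. sin (\<beta> * f x)) \<and> derivs_upto tame n (\<lambda>x. cos (\<beta> * f x))"
proof (induction n)
  case 0
  then show ?case using tame_trig[OF f(1)] by (simp add: derivs_upto_0)
next
  case (Suc n)
  have "derivs_upto rapid n (\<lambda>x. c * deriv f x)" for c
    using schwartz_cmult[OF f(2)] by (simp add: schwartz_iff)
  then have "derivs_upto rapid n (\<lambda>x. \<beta> * deriv f x * cos (\<beta> * f x))"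
    "derivs_upto rapid n (\<lambda>x. (- \<beta>) * deriv f x * sin (\<beta> * f x))"
    using Suc derivs_upto_rapid_mult by blast+
  then have "derivs_upto tame n (\<lambda>x. \<beta> * deriv f x * cos (\<beta> * f x))"
    "derivs_upto tame n (\<lambda>x. (- \<beta>) * deriv f x * sin (\<beta> * f x))"
    by (auto elim: derivs_upto_mono intro: rapid_imp_tame)
  moreover have "deriv (\<lambda>x. sin (\<beta> * f x)) = (\<lambda>x. \<beta> * deriv f x * cos (\<beta> * f x))"
    "deriv (\<lambda>x. cos (\<beta> * f x)) = (\<lambda>x. (- \<beta>) * deriv f x * sin (\<beta> * f x))"
    by (intro ext DERIV_imp_deriv trig_comp_derivs f)+
  ultimately show ?case using tame_trig[OF f(1), of \<beta>] by (simp add: derivs_upto_Suc)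
qed

text \<open>Vacuum asymptotics enter at order zero only. The derivative is
  \<open>\<beta> * deriv f x\<close> times a tame cosine and is covered at every order, so a case
  split on the order replaces induction.\<close>

lemma schwartz_sin_kink:
  assumes "kink \<beta> f" "\<beta> \<noteq> 0"
  shows "schwartz (\<lambda>x. sin (\<beta> * f x))"
  unfolding schwartz_iff
proof
  fix n
  have f: "\<forall>x. f differentiable at x" "schwartz (deriv f)"
    using assms by (auto simp: kink_def)
  have r: "rapid (\<lambda>x. sin (\<beta> * f x))"
    using assms tame_trig(1)[OF f(1), of \<beta>]
    by (auto simp: rapid_def tame_def kink_def vacuum_limit_trig)
  have "deriv (\<lambda>x. sin (\<beta> * f x)) = (\<lambda>x. \<beta> * deriv f x * cos (\<beta> * f x))"
    by (intro ext DERIV_imp_deriv trig_comp_derivs f)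
  moreover have "derivs_upto rapid k (\<lambda>x. \<beta> * deriv f x * cos (\<beta> * f x))" for k
    using schwartz_cmult[OF f(2), of \<beta>] derivs_upto_tame_trig[OF f, of k \<beta>]
    by (intro derivs_upto_rapid_mult[where u = "\<lambda>x. \<beta> * deriv f x"]) (auto simp: schwartz_iff)
  ultimately show "derivs_upto rapid n (\<lambda>x. sin (\<beta> * f x))"
    using r by (cases n) (auto simp: derivs_upto_0 derivs_upto_Suc)
qed

lemma integrable_potential:
  assumes "kink \<beta> f" "\<beta> \<noteq> 0"
  shows "integrable lborel (\<lambda>x. 1 - cos (\<beta> * f x))"
proof (rule integrable_fast_decay)
  have "continuous_on UNIV f"
    using assms(1) by (auto simp: kink_def intro!: continuous_at_imp_continuous_on
        differentiable_imp_continuous_within)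
  then show "continuous_on UNIV (\<lambda>x. 1 - cos (\<beta> * f x))"
    by (intro continuous_intros)
  have *: "((\<lambda>x. (1 + x\<^sup>2) * u x) \<longlongrightarrow> 0) F" if "decays F u" for F and u :: "real \<Rightarrow> real"
  proof -
    \<comment> \<open>The powers 0 and 2 of the decay condition add up to the weight
      \<open>1 + x\<^sup>2\<close>.\<close>
    have "((\<lambda>x. x ^ 0 * u x + x ^ 2 * u x) \<longlongrightarrow> 0) F"
      using that unfolding decays_def by (intro tendsto_add_zero) blast+
    then show ?thesis by (simp add: algebra_simps)
  qed
  show "((\<lambda>x. (1 + x\<^sup>2) * (1 - cos (\<beta> * f x))) \<longlongrightarrow> 0) at_top"
    "((\<lambda>x. (1 + x\<^sup>2) * (1 - cos (\<beta> * f x))) \<longlongrightarrow> 0) at_bot"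
    using assms by (auto intro!: * vacuum_limit_trig simp: kink_def)
qed


section \<open>Functional derivatives of the Hamiltonians\<close>

lemma DERIV_quadratic_error:
  fixes E :: "real \<Rightarrow> real"
  assumes "\<And>\<epsilon>. \<bar>E \<epsilon> - E 0 - \<epsilon> * L\<bar> \<le> \<epsilon>\<^sup>2 * K"
  shows "(E has_real_derivative L) (at 0)"
proof -
  have lim: "((\<lambda>\<epsilon>. \<bar>\<epsilon>\<bar> * K) \<longlongrightarrow> 0) (at 0)"
    by (auto intro!: tendsto_eq_intros)
  \<comment> \<open>Dividing the quadratic error by the parameter leaves a linear one, which
    vanishes in the limit.\<close>
  have "norm ((E \<epsilon> - E 0) / \<epsilon> - L) \<le> \<bar>\<epsilon>\<bar> * K" if "\<epsilon> \<noteq> 0" for \<epsilon>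
  proof -
    have "E \<epsilon> - E 0 - \<epsilon> * L = \<epsilon> * ((E \<epsilon> - E 0) / \<epsilon> - L)"
      using that by (simp add: right_diff_distrib[of \<epsilon> "_ / _"])
    then have "\<bar>\<epsilon>\<bar> * norm ((E \<epsilon> - E 0) / \<epsilon> - L) = \<bar>E \<epsilon> - E 0 - \<epsilon> * L\<bar>"
      by (simp add: abs_mult)
    also have "\<dots> \<le> \<bar>\<epsilon>\<bar> * (\<bar>\<epsilon>\<bar> * K)"
      using assms[of \<epsilon>] by (simp add: power2_eq_square flip: mult.assoc)
    finally show ?thesis using that by simp
  qed
  then have "((\<lambda>\<epsilon>. (E \<epsilon> - E 0) / \<epsilon> - L) \<longlongrightarrow> 0) (at 0)"
    by (intro Lim_null_comparison[OF _ lim]) (simp add: eventually_at_filter)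
  then show ?thesis
    using LIM_zero_cancel by (auto simp: has_field_derivative_iff)
qed

text \<open>Integrating the pointwise remainder bound gives a quadratic error whose constant, the
  integral of \<open>R\<close>, does not depend on the parameter.\<close>

lemma DERIV_integral_quadratic_error:
  fixes G :: "real \<Rightarrow> 'a \<Rightarrow> real"
  assumes G: "\<And>\<epsilon>. integrable M (G \<epsilon>)" and D: "integrable M D" and R: "integrable M R"
    and err: "\<And>\<epsilon> x. \<bar>G \<epsilon> x - G 0 x - \<epsilon> * D x\<bar> \<le> \<epsilon>\<^sup>2 * R x"
  shows "((\<lambda>\<epsilon>. \<integral>x. G \<epsilon> x \<partial>M) has_real_derivative (\<integral>x. D x \<partial>M)) (at 0)"
proof (rule DERIV_quadratic_error)
  fix \<epsilon>
  have I: "integrable M (\<lambda>x. G \<epsilon> x - G 0 x - \<epsilon> * D x)"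
    using G D by simp
  have "\<bar>(\<integral>x. G \<epsilon> x \<partial>M) - (\<integral>x. G 0 x \<partial>M) - \<epsilon> * (\<integral>x. D x \<partial>M)\<bar>
      = \<bar>\<integral>x. G \<epsilon> x - G 0 x - \<epsilon> * D x \<partial>M\<bar>"
    using G D by simp
  also have "\<dots> \<le> (\<integral>x. \<bar>G \<epsilon> x - G 0 x - \<epsilon> * D x\<bar> \<partial>M)"
    by (rule integral_abs_bound)
  also have "\<dots> \<le> (\<integral>x. \<epsilon>\<^sup>2 * R x \<partial>M)"
    using I R err by (intro integral_mono) auto
  finally show "\<bar>(\<integral>x. G \<epsilon> x \<partial>M) - (\<integral>x. G 0 x \<partial>M) - \<epsilon> * (\<integral>x. D x \<partial>M)\<bar> \<le> \<epsilon>\<^sup>2 * (\<integral>x. R x \<partial>M)"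
    by simp
qed

text \<open>The addition theorem splits the error into \<open>cos a * (cos b - 1)\<close> and
  \<open>sin a * (b - sin b)\<close>, each at most \<open>b\<^sup>2 / 2\<close> in absolute
  value.\<close>

lemma cos_linear_error:
  fixes a b :: real
  shows "\<bar>cos (a + b) - cos a + b * sin a\<bar> \<le> b\<^sup>2"
proof -
  \<comment> \<open>Taylor expansion with remainder of order 2: the polynomial part of sine is just
    \<open>b\<close>.\<close>
  have s: "\<bar>b - sin b\<bar> \<le> b\<^sup>2 / 2"
    using Maclaurin_sin_bound[of b 2] by (simp add: numeral_2_eq_2 sin_coeff_def abs_minus_commute)
  have "\<bar>cos b - 1\<bar> = 2 * \<bar>sin (b / 2)\<bar>\<^sup>2"
    using cos_double_sin[of "b / 2"] by simp
  also have "\<dots> \<le> 2 * \<bar>b / 2\<bar>\<^sup>2"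
    by (intro mult_left_mono power_mono abs_sin_x_le_abs_x) auto
  finally have c: "\<bar>cos b - 1\<bar> \<le> b\<^sup>2 / 2"
    by (simp add: power2_eq_square)
  have "cos (a + b) - cos a + b * sin a = cos a * (cos b - 1) + sin a * (b - sin b)"
    by (simp add: cos_add algebra_simps)
  also have "\<bar>\<dots>\<bar> \<le> \<bar>cos a\<bar> * \<bar>cos b - 1\<bar> + \<bar>sin a\<bar> * \<bar>b - sin b\<bar>"
    by (metis abs_mult abs_triangle_ineq)
  also have "\<dots> \<le> 1 * (b\<^sup>2 / 2) + 1 * (b\<^sup>2 / 2)"
    using s c by (intro add_mono mult_mono) auto
  finally show ?thesis by simp
qed

text \<open>The fundamental theorem on the whole line, applied to the product
  \<open>u x * v x\<close>, whose limits at both ends are zero.\<close>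

lemma schwartz_integral_by_parts:
  assumes u: "schwartz u" and v: "schwartz v"
  shows "(LBINT x. u x * deriv v x) = - (LBINT x. deriv u x * v x)"
proof -
  have I: "integrable lborel (\<lambda>x. deriv u x * v x)" "integrable lborel (\<lambda>x. u x * deriv v x)"
    using u v by (auto intro!: integrable_schwartz_mult schwartz_deriv)
  have "(LBINT x=-\<infinity>..\<infinity>. deriv u x * v x + u x * deriv v x) = 0 - 0"
  proof (rule interval_integral_FTC_integrable)
    fix x
    have "(u has_real_derivative deriv u x) (at x)" "(v has_real_derivative deriv v x) (at x)"
      using u v by (auto simp: DERIV_deriv_iff_real_differentiable schwartz_differentiable)
    then show "((\<lambda>x. u x * v x) has_vector_derivative deriv u x * v x + u x * deriv v x) (at x)"
      by (auto intro!: derivative_eq_intros simp flip: has_real_derivative_iff_has_vector_derivative)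
    have "isCont w x" if "schwartz w" for w
      using schwartz_differentiable[OF that] by (rule differentiable_imp_continuous_within)
    then show "isCont (\<lambda>x. deriv u x * v x + u x * deriv v x) x"
      using u v by (intro continuous_intros) (auto intro: schwartz_deriv)
  next
    show "set_integrable lborel (einterval (-\<infinity>) \<infinity>) (\<lambda>x. deriv u x * v x + u x * deriv v x)"
      using I by (simp add: set_integrable_def einterval_def)
    have "((\<lambda>x. u x * v x) \<longlongrightarrow> 0) at_top" "((\<lambda>x. u x * v x) \<longlongrightarrow> 0) at_bot"
      using schwartz_tendsto[OF u, of 0] schwartz_tendsto[OF v, of 0] by (auto intro: tendsto_mult_zero)
    then show "(((\<lambda>x. u x * v x) \<circ> real_of_ereal) \<longlongrightarrow> 0) (at_right (-\<infinity>))"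
      "(((\<lambda>x. u x * v x) \<circ> real_of_ereal) \<longlongrightarrow> 0) (at_left \<infinity>)"
      by (simp_all add: ereal_tendsto_simps1)
  qed auto
  then have "(LBINT x. deriv u x * v x + u x * deriv v x) = 0"
    by (simp add: interval_lebesgue_integral_def set_lebesgue_integral_def einterval_def)
  then show ?thesis using I by simp
qed

text \<open>The momentum and gradient terms share one sign in each Hamiltonian, while the sign of
  the potential is fixed; one parameter \<open>s\<close> thus serves both pictures.\<close>

definition energy :: "real \<Rightarrow> real \<Rightarrow> real \<Rightarrow> (real \<Rightarrow> real) \<Rightarrow> (real \<Rightarrow> real) \<Rightarrow> real" where
  "energy s m \<beta> f p =
     (LBINT x. s/2 * (p x)\<^sup>2 + s/2 * (deriv f x)\<^sup>2 + m\<^sup>2 / \<beta>\<^sup>2 * (1 - cos (\<beta> * f x)))"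

lemma H_S_energy: "H_S m \<beta> = energy 1 m \<beta>"
  by (simp add: H_S_def energy_def fun_eq_iff)

lemma H_T_energy: "H_T m \<beta> = energy (-1) m \<beta>"
  by (simp add: H_T_def energy_def fun_eq_iff)

lemma integrable_energy_density:
  assumes "kink \<beta> f" "schwartz p" "\<beta> \<noteq> 0"
  shows "integrable lborel
    (\<lambda>x. s/2 * (p x)\<^sup>2 + s/2 * (deriv f x)\<^sup>2 + m\<^sup>2 / \<beta>\<^sup>2 * (1 - cos (\<beta> * f x)))"
proof -
  have "integrable lborel (\<lambda>x. (p x)\<^sup>2)" "integrable lborel (\<lambda>x. (deriv f x)\<^sup>2)"
    using assms by (auto simp: power2_eq_square kink_def intro!: integrable_schwartz_mult)
  then show ?thesis
    by (intro Bochner_Integration.integrable_add integrable_mult_right integrable_potential assms)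
qed

text \<open>The density is exactly quadratic in the momentum: the remainder is
  \<open>s / 2 * (\<epsilon>\<^sup>2 * (h x * h x))\<close>, dominated with the coefficient
  \<open>\<bar>s\<bar> * (h x * h x)\<close>.\<close>

lemma energy_momentum_deriv:
  assumes f: "kink \<beta> f" and p: "schwartz p" and \<beta>: "\<beta> \<noteq> 0"
  shows "functional_deriv (\<lambda>v. energy s m \<beta> f v) p = (\<lambda>x. s * p x)"
proof (rule functional_deriv_eq, unfold has_functional_deriv_def, intro conjI allI impI)
  show "schwartz (\<lambda>x. s * p x)" using p by (rule schwartz_cmult)
  fix h assume h: "schwartz h"
  show "((\<lambda>\<epsilon>. energy s m \<beta> f (\<lambda>x. p x + \<epsilon> * h x)) has_real_derivative (LBINT x. s * p x * h x)) (at 0)"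
    unfolding energy_def
  proof (rule DERIV_integral_quadratic_error)
    show "integrable lborel (\<lambda>x. s/2 * (p x + \<epsilon> * h x)\<^sup>2 + s/2 * (deriv f x)\<^sup>2
        + m\<^sup>2 / \<beta>\<^sup>2 * (1 - cos (\<beta> * f x)))" for \<epsilon>
      using p h by (intro integrable_energy_density f \<beta> schwartz_add schwartz_cmult)
    show "integrable lborel (\<lambda>x. s * p x * h x)"
      using p h by (intro integrable_schwartz_mult schwartz_cmult)
    show "integrable lborel (\<lambda>x. \<bar>s\<bar> * (h x * h x))"
      using h by (intro integrable_mult_right integrable_schwartz_mult)
    fix \<epsilon> x
    have "s/2 * (p x + \<epsilon> * h x)\<^sup>2 + s/2 * (deriv f x)\<^sup>2 + m\<^sup>2 / \<beta>\<^sup>2 * (1 - cos (\<beta> * f x))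
        - (s/2 * (p x + 0 * h x)\<^sup>2 + s/2 * (deriv f x)\<^sup>2 + m\<^sup>2 / \<beta>\<^sup>2 * (1 - cos (\<beta> * f x)))
        - \<epsilon> * (s * p x * h x) = s / 2 * (\<epsilon>\<^sup>2 * (h x * h x))"
      by (simp add: field_simps power2_eq_square)
    also have "\<bar>\<dots>\<bar> = \<bar>s\<bar> / 2 * (\<epsilon>\<^sup>2 * (h x * h x))"
      by (simp add: abs_mult)
    also have "\<dots> \<le> \<bar>s\<bar> * (\<epsilon>\<^sup>2 * (h x * h x))"
      by (intro mult_right_mono) auto
    also have "\<dots> = \<epsilon>\<^sup>2 * (\<bar>s\<bar> * (h x * h x))"
      by (simp add: mult.left_commute)
    finally show "\<bar>s/2 * (p x + \<epsilon> * h x)\<^sup>2 + s/2 * (deriv f x)\<^sup>2 + m\<^sup>2 / \<beta>\<^sup>2 * (1 - cos (\<beta> * f x))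
        - (s/2 * (p x + 0 * h x)\<^sup>2 + s/2 * (deriv f x)\<^sup>2 + m\<^sup>2 / \<beta>\<^sup>2 * (1 - cos (\<beta> * f x)))
        - \<epsilon> * (s * p x * h x)\<bar> \<le> \<epsilon>\<^sup>2 * (\<bar>s\<bar> * (h x * h x))" .
  qed
qed

text \<open>Pointwise Taylor estimate: \<open>a\<close>, \<open>c\<close> stand for
  \<open>deriv f x\<close>, \<open>f x\<close>, and \<open>b\<close>, \<open>d\<close> for
  \<open>deriv h x\<close>, \<open>h x\<close>; \<open>q\<close> is the momentum term, which does
  not vary. The \<open>\<beta>\<^sup>2\<close> from the cosine error cancels the one in the
  potential.\<close>

lemma energy_density_error:
  fixes a b c d e q s m \<beta> :: real
  assumes "\<beta> \<noteq> 0"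
  shows "\<bar>(q + s/2 * (a + e * b)\<^sup>2 + m\<^sup>2 / \<beta>\<^sup>2 * (1 - cos (\<beta> * (c + e * d))))
      - (q + s/2 * a\<^sup>2 + m\<^sup>2 / \<beta>\<^sup>2 * (1 - cos (\<beta> * c)))
      - e * (s * (a * b) + m\<^sup>2 / \<beta> * (sin (\<beta> * c) * d))\<bar>
    \<le> e\<^sup>2 * (\<bar>s\<bar> * (b * b) + m\<^sup>2 * (d * d))"
proof -
  define r where "r = cos (\<beta> * c + \<beta> * (e * d)) - cos (\<beta> * c) + \<beta> * (e * d) * sin (\<beta> * c)"
  have r: "\<bar>r\<bar> \<le> (\<beta> * (e * d))\<^sup>2"
    unfolding r_def by (rule cos_linear_error)
  have potential: "m\<^sup>2 / \<beta>\<^sup>2 * r = m\<^sup>2 / \<beta>\<^sup>2 * cos (\<beta> * (c + e * d)) - m\<^sup>2 / \<beta>\<^sup>2 * cos (\<beta> * c)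
      + m\<^sup>2 / \<beta> * (e * d * sin (\<beta> * c))"
  proof -
    have "m\<^sup>2 / \<beta>\<^sup>2 * (\<beta> * y) = m\<^sup>2 / \<beta> * y" for y
      using assms by (simp add: power2_eq_square)
    then show ?thesis
      by (simp add: r_def right_diff_distrib distrib_left mult.assoc)
  qed
  have kinetic: "s/2 * (a + e * b)\<^sup>2 = s/2 * a\<^sup>2 + e * (s * (a * b)) + s/2 * (e\<^sup>2 * (b * b))"
    by (simp add: power2_eq_square algebra_simps)
  have "(q + s/2 * (a + e * b)\<^sup>2 + m\<^sup>2 / \<beta>\<^sup>2 * (1 - cos (\<beta> * (c + e * d))))
      - (q + s/2 * a\<^sup>2 + m\<^sup>2 / \<beta>\<^sup>2 * (1 - cos (\<beta> * c)))
      - e * (s * (a * b) + m\<^sup>2 / \<beta> * (sin (\<beta> * c) * d))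
      = s/2 * (e\<^sup>2 * (b * b)) - m\<^sup>2 / \<beta>\<^sup>2 * r"
    unfolding potential kinetic by (simp add: right_diff_distrib distrib_left mult.left_commute)
  also have "\<bar>\<dots>\<bar> \<le> \<bar>s/2 * (e\<^sup>2 * (b * b))\<bar> + \<bar>m\<^sup>2 / \<beta>\<^sup>2 * r\<bar>"
    by (rule abs_triangle_ineq4)
  also have "\<dots> = \<bar>s\<bar> / 2 * (e\<^sup>2 * (b * b)) + m\<^sup>2 / \<beta>\<^sup>2 * \<bar>r\<bar>"
    by (simp add: abs_mult)
  also have "\<dots> \<le> \<bar>s\<bar> * (e\<^sup>2 * (b * b)) + m\<^sup>2 / \<beta>\<^sup>2 * (\<beta> * (e * d))\<^sup>2"
    using r by (intro add_mono mult_right_mono mult_left_mono) auto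
  also have "\<dots> = e\<^sup>2 * (\<bar>s\<bar> * (b * b) + m\<^sup>2 * (d * d))"
    using assms by (simp add: power_mult_distrib power2_eq_square distrib_left mult.left_commute)
  finally show ?thesis .
qed

text \<open>Differentiation gives the weak form, with \<open>deriv h\<close> paired with
  \<open>deriv f\<close>. Since \<open>deriv f\<close> and \<open>h\<close> are Schwartz functions,
  one integration by parts moves the derivative off \<open>h\<close>.\<close>

lemma energy_field_deriv:
  assumes f: "kink \<beta> f" and p: "schwartz p" and \<beta>: "\<beta> \<noteq> 0"
  shows "functional_deriv (\<lambda>u. energy s m \<beta> u p) f
    = (\<lambda>x. (- s) * deriv (deriv f) x + m\<^sup>2 / \<beta> * sin (\<beta> * f x))"
proof (rule functional_deriv_eq, unfold has_functional_deriv_def, intro conjI allI impI)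
  have f': "schwartz (deriv f)" and fd: "\<forall>x. f differentiable at x"
    using f by (auto simp: kink_def)
  note sf = schwartz_sin_kink[OF f \<beta>]
  show "schwartz (\<lambda>x. (- s) * deriv (deriv f) x + m\<^sup>2 / \<beta> * sin (\<beta> * f x))"
    by (intro schwartz_add schwartz_cmult schwartz_deriv f' sf)
  fix h assume h: "schwartz h"
  have h': "schwartz (deriv h)" using h by (rule schwartz_deriv)
  have d: "deriv (\<lambda>x. f x + \<epsilon> * h x) = (\<lambda>x. deriv f x + \<epsilon> * deriv h x)" for \<epsilon>
  proof
    fix x
    have "(f has_real_derivative deriv f x) (at x)" "(h has_real_derivative deriv h x) (at x)"
      using fd h by (auto simp: DERIV_deriv_iff_real_differentiable schwartz_differentiable)
    then show "deriv (\<lambda>x. f x + \<epsilon> * h x) x = deriv f x + \<epsilon> * deriv h x"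
      by (intro DERIV_imp_deriv) (auto intro!: derivative_eq_intros)
  qed
  have I: "integrable lborel (\<lambda>x. deriv f x * deriv h x)" "integrable lborel (\<lambda>x. sin (\<beta> * f x) * h x)"
    "integrable lborel (\<lambda>x. deriv (deriv f) x * h x)"
    "integrable lborel (\<lambda>x. h x * h x)" "integrable lborel (\<lambda>x. deriv h x * deriv h x)"
    by (intro integrable_schwartz_mult f' h h' sf schwartz_deriv)+
  have "((\<lambda>\<epsilon>. energy s m \<beta> (\<lambda>x. f x + \<epsilon> * h x) p) has_real_derivative
      (LBINT x. s * (deriv f x * deriv h x) + m\<^sup>2 / \<beta> * (sin (\<beta> * f x) * h x))) (at 0)"
    unfolding energy_def
  proof (rule DERIV_integral_quadratic_error)
    show "integrable lborel (\<lambda>x. s/2 * (p x)\<^sup>2 + s/2 * (deriv (\<lambda>x. f x + \<epsilon> * h x) x)\<^sup>2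
        + m\<^sup>2 / \<beta>\<^sup>2 * (1 - cos (\<beta> * (f x + \<epsilon> * h x))))" for \<epsilon>
      by (intro integrable_energy_density kink_add f p h \<beta> schwartz_cmult)
    show "integrable lborel (\<lambda>x. s * (deriv f x * deriv h x) + m\<^sup>2 / \<beta> * (sin (\<beta> * f x) * h x))"
      by (intro Bochner_Integration.integrable_add integrable_mult_right I)
    show "integrable lborel (\<lambda>x. \<bar>s\<bar> * (deriv h x * deriv h x) + m\<^sup>2 * (h x * h x))"
      by (intro Bochner_Integration.integrable_add integrable_mult_right I)
  qed (use energy_density_error[OF \<beta>] in \<open>simp add: d\<close>)
  moreover have "(LBINT x. s * (deriv f x * deriv h x) + m\<^sup>2 / \<beta> * (sin (\<beta> * f x) * h x))
      = s * (LBINT x. deriv f x * deriv h x) + m\<^sup>2 / \<beta> * (LBINT x. sin (\<beta> * f x) * h x)"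
    using I by simp
  moreover have "\<dots> = (LBINT x. (- s) * (deriv (deriv f) x * h x) + m\<^sup>2 / \<beta> * (sin (\<beta> * f x) * h x))"
    using I schwartz_integral_by_parts[OF f' h] by simp
  ultimately show "((\<lambda>\<epsilon>. energy s m \<beta> (\<lambda>x. f x + \<epsilon> * h x) p) has_real_derivative
      (LBINT x. ((- s) * deriv (deriv f) x + m\<^sup>2 / \<beta> * sin (\<beta> * f x)) * h x)) (at 0)"
    by (simp add: algebra_simps)
qed

text \<open>Evaluation at a point is affine in the parameter, so pairing with its functional
  derivative, a delta function, evaluates the direction.\<close>

lemma variation_field:
  "variation (\<lambda>u. field_at x u p) f h = h x"
  "variation (\<lambda>v. field_at x f v) p h = 0"
  unfolding variation_def field_at_def
  by (auto intro!: DERIV_imp_deriv derivative_eq_intros)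

lemma variation_momentum:
  "variation (\<lambda>u. momentum_at x u p) f h = 0"
  "variation (\<lambda>v. momentum_at x f v) p h = h x"
  unfolding variation_def momentum_at_def
  by (auto intro!: DERIV_imp_deriv derivative_eq_intros)

text \<open>A field at a point extracts the momentum derivative of the energy, a momentum extracts
  minus the field derivative; hence the signs on the right.\<close>

lemma bracket_energy:
  assumes "(f, p) \<in> phase_space \<beta>" "\<beta> \<noteq> 0"
  shows "bracket (field_at x) (energy s m \<beta>) f p = s * p x"
    "bracket (momentum_at x) (energy s m \<beta>) f p = s * deriv (deriv f) x - m\<^sup>2 / \<beta> * sin (\<beta> * f x)"
  using energy_momentum_deriv[OF phase_space_kink[OF assms(1)] assms(2)]
    energy_field_deriv[OF phase_space_kink[OF assms(1)] assms(2)]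
  by (simp_all add: bracket_def variation_field variation_momentum)

text \<open>Supplies the differentiability along the slice that \<open>sine_gordon\<close> demands
  and the evolution equations do not mention.\<close>

lemma phase_space_differentiable:
  assumes "(f, p) \<in> phase_space \<beta>"
  shows "f differentiable at x" "deriv f differentiable at x"
  using phase_space_kink(1)[OF assms] by (auto simp: kink_def schwartz_differentiable)


section \<open>The two Hamiltonian systems\<close>

lemma time_evolution_iff:
  assumes ps: "\<forall>t. (\<lambda>x. \<phi> x t, \<lambda>x. p x t) \<in> phase_space \<beta>" and \<beta>: "\<beta> \<noteq> 0"
  shows "time_evolution m \<beta> \<phi> p \<longleftrightarrow> sine_gordon m \<beta> \<phi> \<and> (\<forall>x t. p x t = D\<^sub>t \<phi> x t)"
proof -
  have x: "x_differentiable \<phi>" "x_differentiable (D\<^sub>x \<phi>)"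
    using phase_space_differentiable[OF ps[rule_format]]
    by (auto simp: x_differentiable_def D\<^sub>x_def)
  have 1: "bracket (field_at x) (H_S m \<beta>) (\<lambda>y. \<phi> y t) (\<lambda>y. p y t) = p x t"
    and 2: "bracket (momentum_at x) (H_S m \<beta>) (\<lambda>y. \<phi> y t) (\<lambda>y. p y t)
      = D\<^sub>x (D\<^sub>x \<phi>) x t - m\<^sup>2 / \<beta> * sin (\<beta> * \<phi> x t)" for x t
    using bracket_energy[OF ps[rule_format] \<beta>, of x 1 m] by (simp_all add: H_S_energy D\<^sub>x_def)
  \<comment> \<open>The first equation says \<open>p = D\<^sub>t \<phi>\<close>; substituting it
    turns the conditions on \<open>p\<close> into conditions on
    \<open>D\<^sub>t \<phi>\<close>.\<close>
  have "time_evolution m \<beta> \<phi> p \<longleftrightarrow> p = D\<^sub>t \<phi> \<and> t_differentiable \<phi> \<and> t_differentiable p \<and>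
      (\<forall>x t. D\<^sub>t p x t = D\<^sub>x (D\<^sub>x \<phi>) x t - m\<^sup>2 / \<beta> * sin (\<beta> * \<phi> x t))"
    unfolding time_evolution_def 1 2 by (auto simp: fun_eq_iff)
  also have "\<dots> \<longleftrightarrow> sine_gordon m \<beta> \<phi> \<and> p = D\<^sub>t \<phi>"
    using x by (auto simp: sine_gordon_def algebra_simps)
  finally show ?thesis by (simp add: fun_eq_iff)
qed

lemma D\<^sub>x_uminus: "D\<^sub>x (\<lambda>x t. - u x t) x t = - D\<^sub>x u x t" if "x_differentiable u"
proof -
  have "((\<lambda>y. u y t) has_real_derivative D\<^sub>x u x t) (at x)"
    using that by (simp add: x_differentiable_def D\<^sub>x_def DERIV_deriv_iff_real_differentiable)
  then show ?thesis
    unfolding D\<^sub>x_def[of "\<lambda>x t. - u x t"] by (intro DERIV_imp_deriv DERIV_minus)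
qed

lemma x_differentiable_uminus: "x_differentiable u \<Longrightarrow> x_differentiable (\<lambda>x t. - u x t)"
  by (auto simp: x_differentiable_def)

text \<open>If the relation between momentum and \<open>D\<^sub>x \<phi>\<close> fails, so do both
  sides, since the first equation alone enforces it. If it holds, the sign is carried through a
  further \<open>D\<^sub>x\<close>, using that \<open>D\<^sub>x \<phi>\<close> is
  differentiable.\<close>

lemma space_evolution_iff:
  assumes ps: "\<forall>x. (\<lambda>t. \<phi> x t, \<lambda>t. P x t) \<in> phase_space \<beta>" and \<beta>: "\<beta> \<noteq> 0"
  shows "space_evolution m \<beta> \<phi> P \<longleftrightarrow> sine_gordon m \<beta> \<phi> \<and> (\<forall>x t. P x t = - D\<^sub>x \<phi> x t)"
proof -
  have t: "t_differentiable \<phi>" "t_differentiable (D\<^sub>t \<phi>)"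
    using phase_space_differentiable[OF ps[rule_format]]
    by (auto simp: t_differentiable_def D\<^sub>t_def)
  have 1: "bracket (field_at t) (H_T m \<beta>) (\<lambda>s. \<phi> x s) (\<lambda>s. P x s) = - P x t"
    and 2: "bracket (momentum_at t) (H_T m \<beta>) (\<lambda>s. \<phi> x s) (\<lambda>s. P x s)
      = - D\<^sub>t (D\<^sub>t \<phi>) x t - m\<^sup>2 / \<beta> * sin (\<beta> * \<phi> x t)" for x t
    using bracket_energy[OF ps[rule_format] \<beta>, of t "-1" m] by (simp_all add: H_T_energy D\<^sub>t_def)
  show ?thesis
  proof (cases "P = (\<lambda>x t. - D\<^sub>x \<phi> x t)")
    case True
    \<comment> \<open>Negating \<open>P\<close> gives back \<open>D\<^sub>x \<phi>\<close>, so
      closure under negation yields both directions.\<close>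
    have d: "x_differentiable P \<longleftrightarrow> x_differentiable (D\<^sub>x \<phi>)"
      using x_differentiable_uminus[of P] x_differentiable_uminus[of "D\<^sub>x \<phi>"] by (auto simp: True)
    have D: "D\<^sub>x P x t = - D\<^sub>x (D\<^sub>x \<phi>) x t" if "x_differentiable (D\<^sub>x \<phi>)" for x t
      unfolding True by (rule D\<^sub>x_uminus[OF that])
    have "space_evolution m \<beta> \<phi> P \<longleftrightarrow> x_differentiable \<phi> \<and> x_differentiable (D\<^sub>x \<phi>) \<and>
        (\<forall>x t. - D\<^sub>x (D\<^sub>x \<phi>) x t = - D\<^sub>t (D\<^sub>t \<phi>) x t - m\<^sup>2 / \<beta> * sin (\<beta> * \<phi> x t))"
      unfolding space_evolution_def 1 2 d using D True by auto
    also have "\<dots> \<longleftrightarrow> sine_gordon m \<beta> \<phi>"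
      using t by (auto simp: sine_gordon_def algebra_simps)
    finally show ?thesis using True by simp
  next
    case False
    have "\<not> space_evolution m \<beta> \<phi> P"
    proof
      assume "space_evolution m \<beta> \<phi> P"
      then have "D\<^sub>x \<phi> x t = - P x t" for x t
        unfolding space_evolution_def 1 by blast
      then show False using False by (simp add: fun_eq_iff)
    qed
    then show ?thesis using False by (auto simp: fun_eq_iff)
  qed
qed

theorem mainTheorem3:
  fixes m \<beta> :: real
  assumes "m \<noteq> 0" and "\<beta> \<noteq> 0"
  shows "(\<forall>\<phi> p :: real \<Rightarrow> real \<Rightarrow> real.
            (\<forall>t. (\<lambda>x. \<phi> x t, \<lambda>x. p x t) \<in> phase_space \<beta>) \<longrightarrow>
            (time_evolution m \<beta> \<phi> p \<longleftrightarrow>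
             sine_gordon m \<beta> \<phi> \<and> (\<forall>x t. p x t = D\<^sub>t \<phi> x t)))
       \<and> (\<forall>\<phi> P :: real \<Rightarrow> real \<Rightarrow> real.
            (\<forall>x. (\<lambda>t. \<phi> x t, \<lambda>t. P x t) \<in> phase_space \<beta>) \<longrightarrow>
            (space_evolution m \<beta> \<phi> P \<longleftrightarrow>
             sine_gordon m \<beta> \<phi> \<and> (\<forall>x t. P x t = - D\<^sub>x \<phi> x t)))"
  using time_evolution_iff[OF _ assms(2)] space_evolution_iff[OF _ assms(2)] by blast

end
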